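(* Let $K\subseteq\mathbb{R}^d$ and let $C\subset\mathbb{R}^d$ be a compact convex set with $0\in\operatorname{int}(C)$. Then $$R_\sigma^1(K,C)\leq R_\sigma^2(K,C)\leq\cdots\leq R_\sigma^d(K,C)$$ and $$R^\sigma_1(K,C)\leq R^\sigma_2(K,C)\leq\cdots\leq R^\sigma_d(K,C).$$
   Context: For $0\le i\le d$, $\mathcal{L}^d_i$ denotes the family of all $i$-dimensional linear subspaces of $\mathbb{R}^d$. All infima and suprema are taken in $\mathbb{R}\cup\{\pm\infty\}$, with $\inf\emptyset=+\infty$. The circumradius of a set $A\subseteq\mathbb{R}^d$ with respect to $C$ is $$R(A,C)=\inf_{x\in\mathbb{R}^d}\inf\{\lambda>0 : A\subseteq x+\lambda C\}.$$ For $j\in\{1,\ldots,d\}$ define $$R_\sigma^j(K,C)=\sup_{L\in\mathcal{L}^d_j}\ \sup_{x\in\mathbb{R}^d} R(K\cap(x+L),C),\qquad R^\sigma_j(K,C)=\inf_{L\in\mathcal{L}^d_j}\ \sup_{x\in\mathbb{R}^d} R(K\cap(x+L),C).$$ *)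

theory Defs
  imports "HOL-Analysis.Analysis"
begin

definition lin_subspaces :: "nat \<Rightarrow> 'a::euclidean_space set set" where
  "lin_subspaces i = {L. subspace L \<and> dim L = i}"

text \<open>Infima and suprema are taken in the complete lattice of extended reals, so the infimum of
  the empty set is \<open>\<infinity>\<close>. The circumradius of the empty set is 0.\<close>

definition circumradius :: "'a::euclidean_space set \<Rightarrow> 'a set \<Rightarrow> ereal" where
  "circumradius A C =
     (INF x. INF r\<in>{r::real. r > 0 \<and> A \<subseteq> (\<lambda>c. x + r *\<^sub>R c) ` C}. ereal r)"

text \<open>\<open>R_sigma_sup K C j\<close> is \<open>R\<^sub>\<sigma>\<^sup>j(K,C)\<close> (supremum over the directions \<open>L\<close>) and
  \<open>R_sigma_inf K C j\<close> is \<open>R\<^sup>\<sigma>\<^sub>j(K,C)\<close> (infimum over the directions \<open>L\<close>).\<close>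

definition R_sigma_sup :: "'a::euclidean_space set \<Rightarrow> 'a set \<Rightarrow> nat \<Rightarrow> ereal" where
  "R_sigma_sup K C j =
     (SUP L\<in>lin_subspaces j. SUP x. circumradius (K \<inter> (\<lambda>l. x + l) ` L) C)"

definition R_sigma_inf :: "'a::euclidean_space set \<Rightarrow> 'a set \<Rightarrow> nat \<Rightarrow> ereal" where
  "R_sigma_inf K C j =
     (INF L\<in>lin_subspaces j. SUP x. circumradius (K \<inter> (\<lambda>l. x + l) ` L) C)"

end

theory Submission
  imports Defs
begin

text \<open>Enlarging a set leaves fewer admissible pairs of centre and radius, so its circumradius
  cannot drop. If \<open>L \<subseteq> M\<close>, the section of \<open>K\<close> by
  \<open>x + L\<close> lies in that by \<open>x + M\<close>, so the supremum over all translates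
  grows with the subspace. Both chains then reduce to nesting subspaces of consecutive dimensions,
  in opposite directions: \<open>lin_subspaces_extend\<close> serves the supremum over directions,
  \<open>lin_subspaces_shrink\<close> the infimum.\<close>

lemma circumradius_mono: "A \<subseteq> B \<Longrightarrow> circumradius A C \<le> circumradius B C"
  unfolding circumradius_def by (rule INF_mono, rule bexI[OF _ UNIV_I], rule INF_superset_mono) auto

lemma SUP_circumradius_section_mono:
  assumes "L \<subseteq> M"
  shows "(SUP x. circumradius (K \<inter> (\<lambda>l. x + l) ` L) C)
       \<le> (SUP x. circumradius (K \<inter> (\<lambda>l. x + l) ` M) C)"
  by (rule SUP_mono, rule bexI[OF _ UNIV_I], rule circumradius_mono) (use assms in auto)

text \<open>Adjoining a single vector outside \<open>L\<close> raises the dimension by exactly one;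
  such a vector exists because \<open>j < DIM('a)\<close> makes \<open>L\<close> a proper
  subspace.\<close>

lemma lin_subspaces_extend:
  fixes L :: "'a::euclidean_space set"
  assumes "L \<in> lin_subspaces j" "j < DIM('a)"
  obtains M where "M \<in> lin_subspaces (j + 1)" "L \<subseteq> M"
proof -
  have L: "span L = L" "dim L = j"
    using assms(1) by (simp_all add: lin_subspaces_def)
  then have "L \<noteq> UNIV"
    using assms(2) by auto
  then obtain a where "a \<notin> L"
    by auto
  then have "dim (span (insert a L)) = j + 1"
    \<comment> \<open>\<open>dim_insert\<close> tests membership in \<open>span L\<close>, which is
      \<open>L\<close> itself.\<close>
    by (simp add: dim_insert L)
  then have "span (insert a L) \<in> lin_subspaces (j + 1)"
    by (simp add: lin_subspaces_def)
  moreover have "L \<subseteq> span (insert a L)"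
    by (rule order_trans[OF subset_insertI span_superset])
  ultimately show thesis
    by (rule that)
qed

lemma lin_subspaces_shrink:
  fixes M :: "'a::euclidean_space set"
  assumes "M \<in> lin_subspaces (j + 1)"
  obtains L where "L \<in> lin_subspaces j" "L \<subseteq> M"
proof -
  have "j \<le> dim M" and M: "span M = M"
    using assms by (simp_all add: lin_subspaces_def)
  then obtain L where L: "subspace L" "L \<subseteq> span M" "dim L = j"
    using choose_subspace_of_subspace by metis
  show thesis
  proof (rule that)
    show "L \<in> lin_subspaces j"
      using L by (simp add: lin_subspaces_def)
    show "L \<subseteq> M"
      using L(2) by (simp only: M)
  qed
qed

theorem theorem3p5:
  fixes K C :: "(real ^ 'n) set"
  assumes "compact C" and "convex C" and "0 \<in> interior C"
  shows "(\<forall>j. 1 \<le> j \<and> j < CARD('n) \<longrightarrow> R_sigma_sup K C j \<le> R_sigma_sup K C (j + 1))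
       \<and> (\<forall>j. 1 \<le> j \<and> j < CARD('n) \<longrightarrow> R_sigma_inf K C j \<le> R_sigma_inf K C (j + 1))"
proof (intro conjI allI impI)
  fix j assume j: "1 \<le> j \<and> j < CARD('n)"
  show "R_sigma_sup K C j \<le> R_sigma_sup K C (j + 1)"
    unfolding R_sigma_sup_def
  proof (rule SUP_mono)
    \<comment> \<open>For suprema, each term on the smaller side must be dominated by one on the
      larger side, so \<open>L\<close> is given and is enlarged.\<close>
    fix L :: "(real ^ 'n) set" assume "L \<in> lin_subspaces j"
    then obtain M where "M \<in> lin_subspaces (j + 1)" "L \<subseteq> M"
      using lin_subspaces_extend[of L j] j by auto
    then show "\<exists>M\<in>lin_subspaces (j + 1).
        (SUP x. circumradius (K \<inter> (\<lambda>l. x + l) ` L) C)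
      \<le> (SUP x. circumradius (K \<inter> (\<lambda>l. x + l) ` M) C)"
      by (intro bexI[of _ M] SUP_circumradius_section_mono)
  qed
  show "R_sigma_inf K C j \<le> R_sigma_inf K C (j + 1)"
    unfolding R_sigma_inf_def
  proof (rule INF_mono)
    \<comment> \<open>For infima the roles swap: each term on the larger side must dominate one on
      the smaller side, so \<open>M\<close> is given and a subspace inside it is chosen.\<close>
    fix M :: "(real ^ 'n) set" assume "M \<in> lin_subspaces (j + 1)"
    then obtain L where "L \<in> lin_subspaces j" "L \<subseteq> M"
      by (rule lin_subspaces_shrink)
    then show "\<exists>L\<in>lin_subspaces j.
        (SUP x. circumradius (K \<inter> (\<lambda>l. x + l) ` L) C)
      \<le> (SUP x. circumradius (K \<inter> (\<lambda>l. x + l) ` M) C)"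
      by (intro bexI[of _ L] SUP_circumradius_section_mono)
  qed
qed

end
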